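(* Let $m\geq 3$ be an integer and let $A$ and $P$ be finite sets in the plane, $|P|\ge 3$, each with at most $m-1$ collinear points. Then there is a constant $c=c(P,A)>0$ such that, for all $n$ large enough, \[ S_{P}(n,m)\geq c\,n^{i_{P}(A)}. \]
   Context: Identify the plane with $\mathbb{C}$. Sets $A,B\subseteq\mathbb{C}$ are similar, $A\sim B$, if $B=zA+w$ for some $z,w\in\mathbb{C}$ with $z\neq 0$. For a finite pattern $P$ and a finite set $Q$, $S_P(Q)=|\{P'\subseteq Q: P'\sim P\}|$. For integers $n$ and $m\geq 3$, $S_P(n,m)$ is the maximum of $S_P(Q)$ over all $n$-point sets $Q\subseteq\mathbb{C}$ with no $m$ collinear points. $\mathrm{Iso}^+(P)$ denotes the group of orientation-preserving isometries of the plane mapping $P$ onto itself. The index of a finite set $A$ (with $|A|\ge 2$) with respect to $P$ is \[ i_P(A)=\frac{\log\left(|\mathrm{Iso}^+(P)|\,S_P(A)+|A|\right)}{\log|A|}. \] *)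

theory Defs
  imports "HOL-Analysis.Analysis"
begin

definition similar :: "complex set \<Rightarrow> complex set \<Rightarrow> bool" (infix "\<sim>" 50) where
  "A \<sim> B \<longleftrightarrow> (\<exists>z w. z \<noteq> 0 \<and> B = (\<lambda>x. z * x + w) ` A)"

definition sim_count :: "complex set \<Rightarrow> complex set \<Rightarrow> nat" where
  "sim_count P Q = card {P'. P' \<subseteq> Q \<and> P' \<sim> P}"

definition no_collinear :: "nat \<Rightarrow> complex set \<Rightarrow> bool" where
  "no_collinear m Q \<longleftrightarrow> \<not> (\<exists>T. T \<subseteq> Q \<and> card T = m \<and> collinear T)"

definition max_sim_count :: "complex set \<Rightarrow> nat \<Rightarrow> nat \<Rightarrow> nat" where
  "max_sim_count P n m = Max {sim_count P Q | Q. finite Q \<and> card Q = n \<and> no_collinear m Q}"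

text \<open>The orientation of the triple \<open>(a, b, c)\<close> is the sign of the determinant of the real
  \<open>2 \<times> 2\<close> matrix with columns \<open>b - a\<close> and \<open>c - a\<close>.\<close>

definition orientation :: "complex \<Rightarrow> complex \<Rightarrow> complex \<Rightarrow> real" where
  "orientation a b c = sgn (Re (b - a) * Im (c - a) - Im (b - a) * Re (c - a))"

definition isometry_plane :: "(complex \<Rightarrow> complex) \<Rightarrow> bool" where
  "isometry_plane f \<longleftrightarrow> bij f \<and> (\<forall>x y. dist (f x) (f y) = dist x y)"

definition orientation_preserving :: "(complex \<Rightarrow> complex) \<Rightarrow> bool" where
  "orientation_preserving f \<longleftrightarrow> (\<forall>a b c. orientation (f a) (f b) (f c) = orientation a b c)"

definition Iso_plus :: "complex set \<Rightarrow> (complex \<Rightarrow> complex) set" where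
  "Iso_plus P = {f. isometry_plane f \<and> orientation_preserving f \<and> f ` P = P}"

definition pattern_index :: "complex set \<Rightarrow> complex set \<Rightarrow> real" where
  "pattern_index P A =
     ln (real (card (Iso_plus P)) * real (sim_count P A) + real (card A)) / ln (real (card A))"

lemma orientation_preserving_isometry_iff:
  "isometry_plane f \<and> orientation_preserving f \<longleftrightarrow> (\<exists>a b. norm a = 1 \<and> f = (\<lambda>z. a * z + b))"
proof (intro iffI)
  assume *: "isometry_plane f \<and> orientation_preserving f"
  then have d: "norm (f x - f y) = norm (x - y)" for x y
    by (simp add: isometry_plane_def dist_norm)
  define a where "a = f 1 - f 0"
  have na: "norm a = 1" using d[of 1 0] by (simp add: a_def)
  then have aa: "a * cnj a = 1" by (simp add: complex_norm_square[symmetric])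
  define g where "g z = cnj a * (f z - f 0)" for z
  have n0: "norm (g z) = norm z" for z
    using d[of z 0] na by (simp add: g_def norm_mult)
  have n1: "norm (g z - 1) = norm (z - 1)" for z
  proof -
    have "g z - 1 = cnj a * (f z - f 1)"
      using aa by (simp add: g_def a_def algebra_simps)
    then show ?thesis using d[of z 1] na by (simp add: norm_mult)
  qed
  have "g z = z" for z
  proof -
    have s0: "(Re (g z))\<^sup>2 + (Im (g z))\<^sup>2 = (Re z)\<^sup>2 + (Im z)\<^sup>2"
      using n0[of z] by (metis cmod_power2)
    have s1: "(Re (g z) - 1)\<^sup>2 + (Im (g z))\<^sup>2 = (Re z - 1)\<^sup>2 + (Im z)\<^sup>2"
      using arg_cong[OF n1[of z], of "\<lambda>t. t\<^sup>2"] by (simp add: cmod_power2)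
    have re: "Re (g z) = Re z" using s0 s1 by (simp add: power2_eq_square algebra_simps)
    then have im: "\<bar>Im (g z)\<bar> = \<bar>Im z\<bar>" using s0 by (simp add: power2_eq_iff abs_eq_iff)
    have "orientation (f 0) (f 1) (f z) = orientation 0 1 z"
      using * by (simp add: orientation_preserving_def)
    then have "sgn (Im (g z)) = sgn (Im z)"
      by (simp add: orientation_def g_def a_def algebra_simps)
    with im have "Im (g z) = Im z" by (auto simp: sgn_if split: if_splits)
    with re show ?thesis by (simp add: complex_eq_iff)
  qed
  then have "a * z + f 0 = f z" for z
  proof -
    have "a * z = a * g z" using \<open>g z = z\<close> by simp
    also have "\<dots> = (a * cnj a) * (f z - f 0)" by (simp only: g_def mult.assoc)
    finally show ?thesis using aa by simp
  qed
  with na show "\<exists>a b. norm a = 1 \<and> f = (\<lambda>z. a * z + b)" by metis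
next
  assume "\<exists>a b. norm a = 1 \<and> f = (\<lambda>z. a * z + b)"
  then obtain a b where na: "norm a = 1" and f: "f = (\<lambda>z. a * z + b)" by blast
  then have "a \<noteq> 0" by auto
  have "bij f"
    by (rule o_bij[where g = "\<lambda>z. (z - b) / a"]) (use \<open>a \<noteq> 0\<close> in \<open>auto simp: f field_simps\<close>)
  moreover have "dist (f x) (f y) = dist x y" for x y
    using na by (simp add: f dist_norm norm_mult flip: right_diff_distrib)
  moreover have "orientation (f x) (f y) (f z) = orientation x y z" for x y z
  proof -
    have r: "Re a * Re a + Im a * Im a = 1"
      using na by (simp add: cmod_def power2_eq_square)
    have e: "f u - f x = a * (u - x)" for u by (simp add: f algebra_simps)
    have "Re (a * p) * Im (a * q) - Im (a * p) * Re (a * q)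
        = (Re a * Re a + Im a * Im a) * (Re p * Im q - Im p * Re q)" for p q
      by (simp add: algebra_simps)
    then show ?thesis by (simp only: orientation_def e r mult_1_left)
  qed
  ultimately show "isometry_plane f \<and> orientation_preserving f"
    by (simp add: isometry_plane_def orientation_preserving_def)
qed

lemma sim_count_values_finite:
  "finite {sim_count P Q | Q. finite Q \<and> card Q = n \<and> no_collinear m Q}"
proof (rule finite_subset)
  have "sim_count P Q \<le> 2 ^ n" if "finite Q" "card Q = n" for Q
  proof -
    have "sim_count P Q \<le> card (Pow Q)"
      unfolding sim_count_def by (rule card_mono) (use that in auto)
    then show ?thesis using that by (simp add: card_Pow)
  qed
  then show "{sim_count P Q | Q. finite Q \<and> card Q = n \<and> no_collinear m Q} \<subseteq> {..2 ^ n}" by auto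
qed simp

end

theory Submission
  imports Defs "HOL-Computational_Algebra.Polynomial"
begin

text \<open>
  Count all affine maps \<open>x \<mapsto> a x + b\<close> sending \<open>P\<close> into \<open>A\<close>, the constant ones included. There are
  \<open>N(A) = |Iso\<^sup>+(P)| S\<^sub>P(A) + |A|\<close> of them, and for generic \<open>z\<close> this number is
  supermultiplicative under the sum \<open>A + z B\<close>: if \<open>f\<close> maps \<open>P\<close> into \<open>A\<close> and \<open>g\<close> maps \<open>P\<close> into
  \<open>B\<close>, then \<open>f + z g\<close> maps \<open>P\<close> into \<open>A + z B\<close>. A set of collinear points of \<open>A + z B\<close> projects
  injectively to a collinear subset of \<open>A\<close> or of \<open>B\<close>, so the bound on collinear points survives.
  Iterating gives sets of \<open>|A|\<^sup>j\<close> points with \<open>N \<ge> N(A)\<^sup>j\<close>; other cardinalities are reached by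
  adding generic points. This gives the exponent if \<open>S\<^sub>P(A) > 0\<close>; otherwise the index is \<open>1\<close>, and
  \<open>P\<close> itself can be used in place of \<open>A\<close>.
\<close>

section \<open>Collinearity in the complex plane\<close>

text \<open>Minus the real determinant with columns u and v, so it vanishes exactly when u and v are
  linearly dependent over the reals. Writing it as a complex product makes sums a + z b easy to
  expand.\<close>

definition cross2 :: "complex \<Rightarrow> complex \<Rightarrow> real" where
  "cross2 u v = Im (u * cnj v)"

lemma cross2_eq_0_imp_scaleR:
  assumes "cross2 u v = 0" "u \<noteq> 0"
  shows "\<exists>c. v = c *\<^sub>R u"
proof -
  have "Im (v / u) = 0"
    using assms by (simp add: cross2_def Im_divide mult.commute)
  then have "v / u = of_real (Re (v / u))" by (simp add: complex_eq_iff)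
  then have "v = of_real (Re (v / u)) * u" using assms(2) by (metis nonzero_eq_divide_eq)
  then show ?thesis by (metis scaleR_conv_of_real)
qed

text \<open>Turns collinearity into polynomial equations in the coordinates, so that genericity
  becomes avoidance of roots. Conversely, any nonzero difference of two points of S serves as the
  direction of the line.\<close>

lemma collinear_iff_cross2:
  "collinear S \<longleftrightarrow> (\<forall>x\<in>S. \<forall>y\<in>S. \<forall>z\<in>S. cross2 (y - x) (z - x) = 0)"
proof
  assume "collinear S"
  then obtain u where u: "\<And>x y. x \<in> S \<Longrightarrow> y \<in> S \<Longrightarrow> \<exists>c. x - y = c *\<^sub>R u"
    unfolding collinear_def by blast
  show "\<forall>x\<in>S. \<forall>y\<in>S. \<forall>z\<in>S. cross2 (y - x) (z - x) = 0"
  proof (intro ballI)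
    fix x y z assume "x \<in> S" "y \<in> S" "z \<in> S"
    then obtain c d where "y - x = c *\<^sub>R u" "z - x = d *\<^sub>R u" using u by meson
    then show "cross2 (y - x) (z - x) = 0" by (simp add: cross2_def)
  qed
next
  assume *: "\<forall>x\<in>S. \<forall>y\<in>S. \<forall>z\<in>S. cross2 (y - x) (z - x) = 0"
  show "collinear S"
  proof (cases "\<exists>x\<in>S. \<exists>y\<in>S. x \<noteq> y")
    case True
    then obtain x y where xy: "x \<in> S" "y \<in> S" "y - x \<noteq> 0" by auto
    have c: "\<exists>c. z - x = c *\<^sub>R (y - x)" if "z \<in> S" for z
      using cross2_eq_0_imp_scaleR[of "y - x" "z - x"] * xy that by blast
    show ?thesis unfolding collinear_def
    proof (intro exI[of _ "y - x"] ballI)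
      fix z w assume "z \<in> S" "w \<in> S"
      then obtain c d where "z - x = c *\<^sub>R (y - x)" "w - x = d *\<^sub>R (y - x)" using c by meson
      then have "z - w = (c - d) *\<^sub>R (y - x)"
        by (metis diff_diff_eq2 diff_add_cancel scaleR_diff_left)
      then show "\<exists>c. z - w = c *\<^sub>R (y - x)" by blast
    qed
  next
    case False
    then show ?thesis unfolding collinear_def by (intro exI[of _ 0]) auto
  qed
qed

section \<open>Generic points\<close>

lemma exists_generic_point:
  assumes "finite Q"
  shows "\<exists>p. p \<notin> Q \<and> (\<forall>x\<in>Q. \<forall>y\<in>Q. x \<noteq> y \<longrightarrow> cross2 (y - x) (p - x) \<noteq> 0)"
proof -
  \<comment> \<open>A line meets the parabola \<open>{t + i t\<^sup>2}\<close> in finitely many points.\<close>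
  define p where "p t = Complex t (t\<^sup>2)" for t
  have fin: "finite {t. cross2 (y - x) (p t - x) = 0}" if "x \<noteq> y" for x y
  proof -
    define d where "d = y - x"
    define f where "f = [:- Im d * Re x + Re d * Im x, Im d, - Re d:]"
    have "f \<noteq> 0" using that by (auto simp: f_def d_def complex_eq_iff)
    moreover have "cross2 (y - x) (p t - x) = poly f t" for t
      by (simp add: cross2_def f_def p_def d_def[symmetric] algebra_simps power2_eq_square)
    ultimately show ?thesis using poly_roots_finite[of f] by simp
  qed
  define Bad where
    "Bad = Re ` Q \<union> (\<Union>x\<in>Q. \<Union>y\<in>Q - {x}. {t. cross2 (y - x) (p t - x) = 0})"
  have "finite Bad" unfolding Bad_def using assms fin by (intro finite_UnI finite_UN_I) auto
  then obtain t where t: "t \<notin> Bad" using ex_new_if_finite infinite_UNIV_char_0 by blast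
  have "p t \<notin> Q"
  proof
    assume "p t \<in> Q"
    then have "Re (p t) \<in> Re ` Q" by (rule imageI)
    then show False using t by (simp add: Bad_def p_def)
  qed
  then show ?thesis using t by (intro exI[of _ "p t"]) (auto simp: Bad_def)
qed

text \<open>A new collinear m-subset would contain p and, as m is at least 3, two points of Q; then
  p would lie on the line through them.\<close>

lemma no_collinear_insert_generic:
  assumes "finite Q" "no_collinear m Q" "m \<ge> 3"
  shows "\<exists>p. p \<notin> Q \<and> no_collinear m (insert p Q)"
proof -
  obtain p where p: "p \<notin> Q" "\<And>x y. x \<in> Q \<Longrightarrow> y \<in> Q \<Longrightarrow> x \<noteq> y \<Longrightarrow> cross2 (y - x) (p - x) \<noteq> 0"
    using exists_generic_point[OF assms(1)] by blast
  have False if T: "T \<subseteq> insert p Q" "card T = m" "collinear T" for T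
  proof -
    have pT: "p \<in> T" using assms(2) T unfolding no_collinear_def by blast
    have "finite T" using T assms(1) by (meson finite_insert finite_subset)
    then have "card (T - {p}) \<ge> 2" using pT T assms(3) by simp
    then obtain S where "S \<subseteq> T - {p}" "card S = 2" by (meson obtain_subset_with_card_n)
    then obtain x y where "x \<in> T - {p}" "y \<in> T - {p}" "x \<noteq> y"
      by (auto simp: card_2_iff)
    then show False using p(2)[of x y] T pT collinear_iff_cross2[of T] by auto
  qed
  then show ?thesis using p(1) unfolding no_collinear_def by blast
qed

lemma no_collinear_extend:
  assumes "finite Q" "no_collinear m Q" "m \<ge> 3"
  shows "\<exists>R. Q \<subseteq> R \<and> finite R \<and> card R = card Q + d \<and> no_collinear m R"
proof (induction d)
  case 0
  then show ?case using assms by auto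
next
  case (Suc d)
  then obtain R where R: "Q \<subseteq> R" "finite R" "card R = card Q + d" "no_collinear m R" by blast
  then obtain p where "p \<notin> R" "no_collinear m (insert p R)"
    using no_collinear_insert_generic assms(3) by blast
  then show ?case using R by (intro exI[of _ "insert p R"]) auto
qed

section \<open>Generic sums\<close>

lemma finite_collinear_parameters:
  fixes p q r s :: complex
  assumes "\<not> (cross2 p q = 0 \<and> cross2 r s = 0 \<and> r * cnj q = cnj p * s)"
  shows "finite {t. cross2 (p + Complex t (t ^ 3) * r) (q + Complex t (t ^ 3) * s) = 0}"
proof -
  \<comment> \<open>On the curve \<open>t + i t\<^sup>3\<close> the monomials occurring in the three terms do not overlap.\<close>
  define w where "w = r * cnj q - cnj p * s"
  \<comment> \<open>With z = t + i t^3 the expression expands to \<open>cross2 p q\<close> + |z|^2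
    \<open>cross2 r s\<close> + Im (z w), where |z|^2 = t^2 + t^6 and Im (z w) = t Im w + t^3 Re
    w.\<close>
  define f where "f = [:cross2 p q, Im w, cross2 r s, Re w, 0, 0, cross2 r s:]"
  have "f \<noteq> 0" using assms by (auto simp: f_def w_def complex_eq_iff)
  moreover have "cross2 (p + Complex t (t ^ 3) * r) (q + Complex t (t ^ 3) * s) = poly f t" for t
    by (simp add: cross2_def f_def w_def algebra_simps power3_eq_cube)
  ultimately show ?thesis using poly_roots_finite[of f] by simp
qed

text \<open>The three equations in the conclusion say that the triple is collinear for every z. Any
  other triple is collinear for only finitely many parameters on the curve, so a suitable z leaves
  only the forced collinearities.\<close>

lemma exists_generic_scaling:
  fixes A B :: "complex set"
  assumes "finite A" "finite B"
  shows "\<exists>z. inj_on (\<lambda>(a, b). a + z * b) (A \<times> B) \<and>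
    (\<forall>a1\<in>A. \<forall>a2\<in>A. \<forall>a3\<in>A. \<forall>b1\<in>B. \<forall>b2\<in>B. \<forall>b3\<in>B.
      cross2 ((a2 + z * b2) - (a1 + z * b1)) ((a3 + z * b3) - (a1 + z * b1)) = 0 \<longrightarrow>
      cross2 (a2 - a1) (a3 - a1) = 0 \<and> cross2 (b2 - b1) (b3 - b1) = 0 \<and>
      (b2 - b1) * cnj (a3 - a1) = cnj (a2 - a1) * (b3 - b1))"
proof -
  define z where "z t = Complex t (t ^ 3)" for t
  define D where "D = (\<lambda>(x, y). x - y) ` (A \<times> A)"
  define E where "E = (\<lambda>(x, y). x - y) ` (B \<times> B)"
  define good where "good p q r s \<longleftrightarrow> cross2 p q = 0 \<and> cross2 r s = 0 \<and> r * cnj q = cnj p * s"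
    for p q r s
  \<comment> \<open>A coincidence a + z b = a' + z b' with b and b' distinct determines z as a
    quotient of differences. Recording real parts suffices because
    \<open>Re (z t) = t\<close>.\<close>
  define Bad1 where "Bad1 = (\<lambda>(p, r). Re (p / r)) ` (D \<times> E)"
  define Bad2 where "Bad2 = (\<Union>(p, q, r, s) \<in> {(p, q, r, s) \<in> D \<times> D \<times> E \<times> E. \<not> good p q r s}.
    {t. cross2 (p + z t * r) (q + z t * s) = 0})"
  have finD: "finite D" "finite E" using assms by (auto simp: D_def E_def)
  have "finite Bad1" using finD by (auto simp: Bad1_def)
  moreover have "finite Bad2" unfolding Bad2_def
  proof (rule finite_UN_I)
    show "finite {(p, q, r, s) \<in> D \<times> D \<times> E \<times> E. \<not> good p q r s}"
      by (rule finite_subset[of _ "D \<times> D \<times> E \<times> E"]) (use finD in auto)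
  qed (use finite_collinear_parameters in \<open>auto simp: z_def good_def\<close>)
  ultimately obtain t where t: "t \<notin> Bad1" "t \<notin> Bad2"
    using ex_new_if_finite[of "Bad1 \<union> Bad2"] infinite_UNIV_char_0 by blast
  have inj: "a = a' \<and> b = b'"
    if "a \<in> A" "a' \<in> A" "b \<in> B" "b' \<in> B" "a + z t * b = a' + z t * b'" for a a' b b'
  proof (cases "b = b'")
    case False
    then have "z t = (a' - a) / (b - b')" using that(5) by (simp add: field_simps)
    moreover have "a' - a \<in> D" "b - b' \<in> E" using that by (auto simp: D_def E_def)
    ultimately have "Re (z t) \<in> Bad1" unfolding Bad1_def by force
    then show ?thesis using t by (simp add: z_def)
  qed (use that in simp)
  have col: "good (a2 - a1) (a3 - a1) (b2 - b1) (b3 - b1)"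
    if "a1 \<in> A" "a2 \<in> A" "a3 \<in> A" "b1 \<in> B" "b2 \<in> B" "b3 \<in> B"
      "cross2 ((a2 + z t * b2) - (a1 + z t * b1)) ((a3 + z t * b3) - (a1 + z t * b1)) = 0"
    for a1 a2 a3 b1 b2 b3
  proof (rule ccontr)
    assume bad: "\<not> good (a2 - a1) (a3 - a1) (b2 - b1) (b3 - b1)"
    have "a2 - a1 \<in> D" "a3 - a1 \<in> D" "b2 - b1 \<in> E" "b3 - b1 \<in> E"
      using that by (auto simp: D_def E_def)
    moreover have "cross2 ((a2 - a1) + z t * (b2 - b1)) ((a3 - a1) + z t * (b3 - b1)) = 0"
      using that(7) by (simp add: algebra_simps)
    ultimately have "t \<in> Bad2" unfolding Bad2_def using bad by blast
    then show False using t by blast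
  qed
  show ?thesis
  proof (intro exI[of _ "z t"] conjI ballI impI)
    show "inj_on (\<lambda>(a, b). a + z t * b) (A \<times> B)" using inj by (auto simp: inj_on_def)
  qed (use col in \<open>simp_all add: good_def\<close>)
qed

text \<open>Lift a collinear set to U in the product; by the choice of z both projections of U are
  collinear. Either the first projection is injective on U, contradicting the bound for A, or all
  first coordinates agree, so the second is injective and contradicts the bound for B.\<close>

lemma exists_generic_sum:
  assumes "finite A" "finite B" "no_collinear m A" "no_collinear m B"
  shows "\<exists>z. inj_on (\<lambda>(a, b). a + z * b) (A \<times> B) \<and>
    no_collinear m ((\<lambda>(a, b). a + z * b) ` (A \<times> B))"
proof -
  obtain z where inj: "inj_on (\<lambda>(a, b). a + z * b) (A \<times> B)" and
    col: "\<And>a1 a2 a3 b1 b2 b3. \<lbrakk>a1 \<in> A; a2 \<in> A; a3 \<in> A; b1 \<in> B; b2 \<in> B; b3 \<in> B;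
      cross2 ((a2 + z * b2) - (a1 + z * b1)) ((a3 + z * b3) - (a1 + z * b1)) = 0\<rbrakk> \<Longrightarrow>
      cross2 (a2 - a1) (a3 - a1) = 0 \<and> cross2 (b2 - b1) (b3 - b1) = 0 \<and>
      (b2 - b1) * cnj (a3 - a1) = cnj (a2 - a1) * (b3 - b1)"
    using exists_generic_scaling[OF assms(1,2)] by metis
  define h where "h = (\<lambda>(a, b). a + z * b)"
  have False if T: "T \<subseteq> h ` (A \<times> B)" "card T = m" "collinear T" for T
  proof -
    obtain U where U: "U \<subseteq> A \<times> B" "T = h ` U" using T(1) by (meson subset_imageE)
    have "inj_on h U" using inj U(1) unfolding h_def by (rule inj_on_subset)
    then have cardU: "card U = m" using T(2) U(2) by (simp add: card_image)
    have g: "cross2 (a2 - a1) (a3 - a1) = 0 \<and> cross2 (b2 - b1) (b3 - b1) = 0 \<and>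
        (b2 - b1) * cnj (a3 - a1) = cnj (a2 - a1) * (b3 - b1)"
      if "(a1, b1) \<in> U" "(a2, b2) \<in> U" "(a3, b3) \<in> U" for a1 a2 a3 b1 b2 b3
    proof -
      have "h (a1, b1) \<in> T" "h (a2, b2) \<in> T" "h (a3, b3) \<in> T" using that U(2) by auto
      then have "cross2 (h (a2, b2) - h (a1, b1)) (h (a3, b3) - h (a1, b1)) = 0"
        using T(3) collinear_iff_cross2 by blast
      then show ?thesis using col[of a1 a2 a3 b1 b2 b3] that U(1) by (auto simp: h_def)
    qed
    show False
    proof (cases "inj_on fst U")
      case True
      have "collinear (fst ` U)" unfolding collinear_iff_cross2 using g by force
      moreover have "fst ` U \<subseteq> A" using U(1) by auto
      moreover have "card (fst ` U) = m" using True cardU by (simp add: card_image)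
      ultimately show False using assms(3) by (auto simp: no_collinear_def)
    next
      case False
      then obtain a b b' where ab: "(a, b) \<in> U" "(a, b') \<in> U" "b \<noteq> b'"
        unfolding inj_on_def by (metis prod.collapse)
      \<comment> \<open>For two points with the same first coordinate the third equation reduces to
        \<open>(b' - b) * cnj (x - a) = 0\<close>.\<close>
      have fst: "x = a" if "(x, y) \<in> U" for x y
        using g[OF ab(1) ab(2) that] ab(3) by simp
      have "inj_on snd U" using fst by (auto simp: inj_on_def)
      then have "card (snd ` U) = m" using cardU by (simp add: card_image)
      moreover have "collinear (snd ` U)" unfolding collinear_iff_cross2 using g by force
      moreover have "snd ` U \<subseteq> B" using U(1) by auto
      ultimately show False using assms(4) by (auto simp: no_collinear_def)
    qed
  qed
  then show ?thesis using inj unfolding no_collinear_def h_def by blast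
qed

section \<open>Counting affine maps\<close>

definition affine_maps :: "complex set \<Rightarrow> complex set \<Rightarrow> (complex \<times> complex) set" where
  "affine_maps P A = {(a, b). \<forall>x\<in>P. a * x + b \<in> A}"

lemma affine_eq_on_two_points:
  fixes a b a' b' x y :: complex
  assumes "a * x + b = a' * x + b'" "a * y + b = a' * y + b'" "x \<noteq> y"
  shows "a = a' \<and> b = b'"
proof -
  have "(a - a') * (x - y) = (a * x + b - (a' * x + b')) - (a * y + b - (a' * y + b'))"
    by (simp add: algebra_simps)
  then have "(a - a') * (x - y) = 0" using assms(1,2) by simp
  then show ?thesis using assms by simp
qed

lemma finite_affine_maps:
  assumes "finite A" "x \<in> P" "y \<in> P" "x \<noteq> y"
  shows "finite (affine_maps P A)"
proof (rule inj_on_finite)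
  show "inj_on (\<lambda>(a, b). (a * x + b, a * y + b)) (affine_maps P A)"
    using affine_eq_on_two_points[OF _ _ assms(4)] by (auto simp: inj_on_def)
  show "(\<lambda>(a, b). (a * x + b, a * y + b)) ` affine_maps P A \<subseteq> A \<times> A"
    using assms by (auto simp: affine_maps_def)
qed (use assms in auto)

text \<open>The pair (f, g) is recovered from f + z g: injectivity on the product splits each value
  into f(u) and g(u), and the values at two points of P determine both maps.\<close>

lemma card_affine_maps_sum:
  assumes "finite A" "finite B" "x \<in> P" "y \<in> P" "x \<noteq> y"
    and inj: "inj_on (\<lambda>(a, b). a + z * b) (A \<times> B)"
  shows "card (affine_maps P A) * card (affine_maps P B)
    \<le> card (affine_maps P ((\<lambda>(a, b). a + z * b) ` (A \<times> B)))"
proof -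
  let ?C = "(\<lambda>(a, b). a + z * b) ` (A \<times> B)"
  let ?h = "\<lambda>((a, b), (c, d)). (a + z * c, b + z * d)"
  have split: "(a + z * c) * u + (b + z * d) = (a * u + b) + z * (c * u + d)" for a b c d u
    by (simp add: algebra_simps)
  have "inj_on ?h (affine_maps P A \<times> affine_maps P B)"
  proof (clarsimp simp: inj_on_def)
    fix a b c d a' b' c' d'
    assume m: "(a, b) \<in> affine_maps P A" "(c, d) \<in> affine_maps P B"
      "(a', b') \<in> affine_maps P A" "(c', d') \<in> affine_maps P B"
      and e: "a + z * c = a' + z * c'" "b + z * d = b' + z * d'"
    have u: "a * u + b = a' * u + b' \<and> c * u + d = c' * u + d'" if "u \<in> P" for u
    proof -
      have "(a * u + b) + z * (c * u + d) = (a' * u + b') + z * (c' * u + d')"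
        using e by (simp only: split[symmetric])
      moreover have "a * u + b \<in> A" "c * u + d \<in> B" "a' * u + b' \<in> A" "c' * u + d' \<in> B"
        using m that by (auto simp: affine_maps_def)
      ultimately show ?thesis
        using inj_onD[OF inj, of "(a * u + b, c * u + d)" "(a' * u + b', c' * u + d')"] by auto
    qed
    show "a = a' \<and> b = b' \<and> c = c' \<and> d = d'"
      using affine_eq_on_two_points[OF _ _ assms(5)] u[OF assms(3)] u[OF assms(4)] by blast
  qed
  moreover have "?h ` (affine_maps P A \<times> affine_maps P B) \<subseteq> affine_maps P ?C"
    by (force simp: affine_maps_def split)
  moreover have "finite (affine_maps P ?C)"
    using finite_affine_maps[of ?C x P y] assms by auto
  ultimately have "card (affine_maps P A \<times> affine_maps P B) \<le> card (affine_maps P ?C)"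
    by (rule card_inj_on_le)
  then show ?thesis by (simp add: card_cartesian_product)
qed

section \<open>Affine symmetries of the pattern\<close>

lemma norm_eq_1_if_affine_image_eq:
  fixes P :: "complex set"
  assumes "finite P" "x \<in> P" "y \<in> P" "x \<noteq> y" "a \<noteq> 0" "(\<lambda>u. a * u + b) ` P = P"
  shows "norm a = 1"
proof -
  \<comment> \<open>The sum of all pairwise distances is invariant and scales by \<open>norm a\<close>.\<close>
  let ?f = "\<lambda>u. a * u + b"
  let ?s = "\<Sum>u\<in>P. \<Sum>v\<in>P. norm (u - v)"
  have inj: "inj_on ?f P" using assms(5) by (auto simp: inj_on_def)
  have re: "(\<Sum>u\<in>P. g u) = (\<Sum>u\<in>P. g (?f u))" for g :: "complex \<Rightarrow> real"
    using sum.reindex[OF inj, of g] assms(6) by simp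
  have "?s = (\<Sum>u\<in>P. \<Sum>v\<in>P. norm (?f u - v))" by (rule re)
  also have "\<dots> = (\<Sum>u\<in>P. \<Sum>v\<in>P. norm (?f u - ?f v))" by (intro sum.cong refl re)
  also have "\<dots> = (\<Sum>u\<in>P. \<Sum>v\<in>P. norm a * norm (u - v))"
    by (simp add: norm_mult flip: right_diff_distrib)
  also have "\<dots> = norm a * ?s" by (simp add: sum_distrib_left)
  finally have "?s = norm a * ?s" .
  moreover have "?s > 0"
  proof (rule sum_pos2[OF assms(1,2)])
    show "(\<Sum>v\<in>P. norm (x - v)) > 0"
      by (rule sum_pos2[OF assms(1,3)]) (use assms(4) in auto)
  qed (simp add: sum_nonneg)
  ultimately show ?thesis by simp
qed

text \<open>A nonconstant affine map that permutes a finite set with two or more points cannot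
  scale, so the isometry condition comes for free and only the condition on the image of P
  remains.\<close>

lemma Iso_plus_eq_affine:
  fixes P :: "complex set"
  assumes "finite P" "x \<in> P" "y \<in> P" "x \<noteq> y"
  shows "Iso_plus P = (\<lambda>(a, b) u. a * u + b) ` {(a, b). a \<noteq> 0 \<and> (\<lambda>u. a * u + b) ` P = P}"
    (is "_ = ?c ` ?G")
proof
  show "Iso_plus P \<subseteq> ?c ` ?G"
  proof
    fix f assume "f \<in> Iso_plus P"
    then obtain a b where "norm a = 1" "f = (\<lambda>u. a * u + b)" "f ` P = P"
      using orientation_preserving_isometry_iff unfolding Iso_plus_def by blast
    then show "f \<in> ?c ` ?G" by (intro image_eqI[of _ _ "(a, b)"]) auto
  qed
  show "?c ` ?G \<subseteq> Iso_plus P"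
  proof
    fix f assume "f \<in> ?c ` ?G"
    then obtain a b where ab: "a \<noteq> 0" "f = (\<lambda>u. a * u + b)" "f ` P = P" by auto
    then have "norm a = 1" using norm_eq_1_if_affine_image_eq[OF assms] by blast
    then have "isometry_plane f \<and> orientation_preserving f"
      using orientation_preserving_isometry_iff ab(2) by blast
    then show "f \<in> Iso_plus P" using ab(3) unfolding Iso_plus_def by blast
  qed
qed

lemma card_Iso_plus:
  fixes P :: "complex set"
  assumes "finite P" "x \<in> P" "y \<in> P" "x \<noteq> y"
  shows "card (Iso_plus P) = card {(a, b). a \<noteq> 0 \<and> (\<lambda>u. a * u + b) ` P = P}"
proof -
  have "inj_on (\<lambda>(a, b) u. a * u + b :: complex) X" for X
  proof (clarsimp simp: inj_on_def)
    fix a b a' b' :: complex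
    assume "(\<lambda>u. a * u + b) = (\<lambda>u. a' * u + b')"
    then have e: "a * u + b = a' * u + b'" for u by metis
    show "a = a' \<and> b = b'" using affine_eq_on_two_points[OF e e zero_neq_one] .
  qed
  then show ?thesis by (simp only: Iso_plus_eq_affine[OF assms] card_image)
qed

text \<open>\<open>similar\<close> presents P as an image of P'; counting maps out of P needs the
  inverse map.\<close>

lemma similar_iff_affine_image:
  "P' \<sim> P \<longleftrightarrow> (\<exists>a b. a \<noteq> 0 \<and> P' = (\<lambda>u. a * u + b) ` P)"
proof -
  have inv: "\<exists>a b. a \<noteq> 0 \<and> X = (\<lambda>u. a * u + b) ` Y"
    if "z \<noteq> 0" "Y = (\<lambda>u. z * u + w) ` X" for X Y :: "complex set" and z w
  proof (intro exI conjI)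
    show "inverse z \<noteq> 0" using that by simp
    show "X = (\<lambda>u. inverse z * u + (- w / z)) ` Y"
      using that by (simp add: image_image field_simps)
  qed
  show ?thesis unfolding similar_def using inv by blast
qed

text \<open>The maps of P onto P' form a coset of the symmetry group of P: compose with one fixed
  similarity from P to P'.\<close>

lemma card_affine_maps_onto:
  fixes P :: "complex set"
  assumes "P' \<sim> P"
  shows "card {(a, b). a \<noteq> 0 \<and> (\<lambda>u. a * u + b) ` P = P'}
    = card {(a, b). a \<noteq> 0 \<and> (\<lambda>u. a * u + b) ` P = P}"
proof -
  obtain c d where cd: "c \<noteq> 0" "P' = (\<lambda>u. c * u + d) ` P"
    using assms similar_iff_affine_image by blast
  have "bij_betw (\<lambda>(a, b). (c * a, c * b + d))
    {(a, b). a \<noteq> 0 \<and> (\<lambda>u. a * u + b) ` P = P} {(a, b). a \<noteq> 0 \<and> (\<lambda>u. a * u + b) ` P = P'}"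
    (is "bij_betw ?h ?X ?Y")
  proof (rule bij_betw_byWitness[where f' = "\<lambda>(a, b). (a / c, (b - d) / c)"])
    show "?h ` ?X \<subseteq> ?Y"
    proof clarsimp
      fix a b assume "a \<noteq> 0" and e: "(\<lambda>u. a * u + b) ` P = P"
      have "(\<lambda>u. c * a * u + (c * b + d)) ` P = (\<lambda>u. c * u + d) ` (\<lambda>u. a * u + b) ` P"
        by (simp add: image_image algebra_simps)
      then show "c \<noteq> 0 \<and> (\<lambda>u. c * a * u + (c * b + d)) ` P = P'" using cd e by simp
    qed
    show "(\<lambda>(a, b). (a / c, (b - d) / c)) ` ?Y \<subseteq> ?X"
    proof (rule image_subsetI)
      fix s assume "s \<in> ?Y"
      then obtain a b where s: "s = (a, b)" "a \<noteq> 0" and e: "(\<lambda>u. a * u + b) ` P = P'" by blast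
      have "(\<lambda>u. a / c * u + (b - d) / c) ` P = (\<lambda>v. (v - d) / c) ` (\<lambda>u. a * u + b) ` P"
        by (simp add: image_image diff_divide_distrib add_divide_distrib algebra_simps)
      also have "\<dots> = P" unfolding e cd(2) using cd(1) by (simp add: image_image)
      finally have "(\<lambda>u. a / c * u + (b - d) / c) ` P = P" .
      then show "(case s of (a, b) \<Rightarrow> (a / c, (b - d) / c)) \<in> ?X" using s cd(1) by simp
    qed
  qed (use cd in auto)
  then show ?thesis by (simp add: bij_betw_same_card)
qed

text \<open>Sort the maps by the image of P. Each copy P' in A is the image under as many maps as P
  has symmetries, and the constant maps contribute one for each point of A.\<close>

lemma card_affine_maps:
  fixes P A :: "complex set"
  assumes "finite P" "finite A" "x \<in> P" "y \<in> P" "x \<noteq> y"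
  shows "card (affine_maps P A) = card (Iso_plus P) * sim_count P A + card A"
proof -
  define F where "F P' = {(a, b). a \<noteq> 0 \<and> (\<lambda>u. a * u + b) ` P = P'}" for P'
  define I where "I = {P'. P' \<subseteq> A \<and> P' \<sim> P}"
  have fin: "finite (affine_maps P A)" using finite_affine_maps assms by blast
  have eq: "affine_maps P A = (\<Union>P'\<in>I. F P') \<union> Pair 0 ` A" (is "_ = ?L \<union> ?R")
  proof (intro set_eqI iffI)
    fix s assume s: "s \<in> affine_maps P A"
    obtain a b where ab: "s = (a, b)" by (cases s)
    show "s \<in> ?L \<union> ?R"
    proof (cases "a = 0")
      case True
      then show ?thesis using s ab assms(3) by (auto simp: affine_maps_def)
    next
      case False
      then have "(\<lambda>u. a * u + b) ` P \<in> I" using s ab similar_iff_affine_image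
        by (auto simp: I_def affine_maps_def)
      then show ?thesis using False ab by (auto simp: F_def)
    qed
  qed (auto simp: affine_maps_def F_def I_def)
  have sub: "finite ?L" "finite ?R" using fin unfolding eq by simp_all
  have "?L \<inter> ?R = {}" by (auto simp: F_def)
  then have "card (affine_maps P A) = card ?L + card ?R"
    unfolding eq by (rule card_Un_disjoint[OF sub])
  also have "card ?R = card A" by (simp add: card_image inj_on_def)
  also have "card ?L = (\<Sum>P'\<in>I. card (F P'))"
  proof (rule card_UN_disjoint)
    show "finite I" using assms(2) by (simp add: I_def)
    show "\<forall>P'\<in>I. finite (F P')" using sub(1) by (meson UN_upper finite_subset)
    show "\<forall>P'\<in>I. \<forall>P''\<in>I. P' \<noteq> P'' \<longrightarrow> F P' \<inter> F P'' = {}" by (auto simp: F_def)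
  qed
  also have "\<dots> = (\<Sum>P'\<in>I. card (Iso_plus P))"
    using card_affine_maps_onto card_Iso_plus[OF assms(1,3,4,5)]
    by (intro sum.cong) (simp_all add: I_def F_def)
  also have "\<dots> = card (Iso_plus P) * sim_count P A" by (simp add: sim_count_def I_def)
  finally show ?thesis .
qed

text \<open>The identity alone does not suffice, because \<open>card\<close> is 0 on infinite sets;
  finiteness comes from the symmetries being affine maps of P into itself.\<close>

lemma card_Iso_plus_pos:
  fixes P :: "complex set"
  assumes "finite P" "x \<in> P" "y \<in> P" "x \<noteq> y"
  shows "card (Iso_plus P) > 0"
proof -
  let ?G = "{(a, b). a \<noteq> 0 \<and> (\<lambda>u. a * u + b) ` P = P}"
  have "finite ?G"
    by (rule finite_subset[OF _ finite_affine_maps[OF assms]]) (auto simp: affine_maps_def)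
  moreover have "(1, 0) \<in> ?G" by simp
  ultimately have "card ?G > 0" unfolding card_gt_0_iff by blast
  then show ?thesis by (simp only: card_Iso_plus[OF assms])
qed

section \<open>The lower bound\<close>

lemma iterated_generic_sum:
  assumes "finite P" "x \<in> P" "y \<in> P" "x \<noteq> y" "finite A" "no_collinear m A" "m \<ge> 3"
  shows "\<exists>B. finite B \<and> card B = card A ^ j \<and> no_collinear m B \<and>
    card (affine_maps P A) ^ j \<le> card (affine_maps P B)"
proof (induction j)
  case 0
  \<comment> \<open>A single point plays the role of the empty sum, and the zero map supplies the
    one required map.\<close>
  have "no_collinear m {0}"
    using assms(7) by (auto simp: no_collinear_def subset_singleton_iff)
  moreover have "(0, 0) \<in> affine_maps P {0}" by (simp add: affine_maps_def)
  then have "card (affine_maps P {0}) > 0"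
    using finite_affine_maps[OF _ assms(2,3,4), of "{0}"] unfolding card_gt_0_iff by blast
  ultimately show ?case by (intro exI[of _ "{0}"]) auto
next
  case (Suc j)
  then obtain B where B: "finite B" "card B = card A ^ j" "no_collinear m B"
    "card (affine_maps P A) ^ j \<le> card (affine_maps P B)" by blast
  obtain z where inj: "inj_on (\<lambda>(a, b). a + z * b) (A \<times> B)"
    and col: "no_collinear m ((\<lambda>(a, b). a + z * b) ` (A \<times> B))"
    using exists_generic_sum assms(5,6) B(1,3) by blast
  let ?C = "(\<lambda>(a, b). a + z * b) ` (A \<times> B)"
  have "card (affine_maps P A) ^ Suc j \<le> card (affine_maps P A) * card (affine_maps P B)"
    using B(4) by simp
  also have "\<dots> \<le> card (affine_maps P ?C)"
    using card_affine_maps_sum[OF assms(5) B(1) assms(2-4) inj] .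
  finally have "card (affine_maps P A) ^ Suc j \<le> card (affine_maps P ?C)" .
  moreover have "card ?C = card A ^ Suc j"
    using card_image[OF inj] B(2) by (simp add: card_cartesian_product)
  ultimately show ?case using col assms(5) B(1) by (intro exI[of _ ?C]) auto
qed

lemma sim_count_mono:
  assumes "finite R" "Q \<subseteq> R"
  shows "sim_count P Q \<le> sim_count P R"
  unfolding sim_count_def by (rule card_mono) (use assms in auto)

text \<open>Pad Q with generic points to exactly n points; no copy of P is lost.\<close>

lemma max_sim_count_ge:
  assumes "finite Q" "card Q \<le> n" "no_collinear m Q" "m \<ge> 3"
  shows "sim_count P Q \<le> max_sim_count P n m"
proof -
  obtain R where R: "Q \<subseteq> R" "finite R" "card R = card Q + (n - card Q)" "no_collinear m R"
    using no_collinear_extend[OF assms(1,3,4)] by blast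
  have "sim_count P R \<le> max_sim_count P n m" unfolding max_sim_count_def
    by (rule Max_ge[OF sim_count_values_finite]) (use R assms(2) in auto)
  then show ?thesis using sim_count_mono[OF R(2,1)] le_trans by blast
qed

text \<open>The index is the exponent for which one factor |A| in the number of points corresponds
  to one factor N(A) in the number of affine maps.\<close>

lemma card_powr_pattern_index:
  assumes "card A \<ge> 2"
  shows "real (card A) powr pattern_index P A
    = real (card (Iso_plus P) * sim_count P A + card A)"
proof -
  have "ln (real (card A)) > 0" using assms by simp
  moreover have "real (card (Iso_plus P)) * real (sim_count P A) + real (card A) > 0"
    using assms by (intro add_nonneg_pos) auto
  ultimately show ?thesis using assms by (auto simp: powr_def pattern_index_def)
qed

text \<open>A copy of P in A makes N exceed k = |A|, so the k^j constant maps into the j-fold sum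
  are at most a fixed fraction of the N^j maps guaranteed there. Choosing j with k^j at most n and n
  below k^(j+1) covers all n. The constant depends on A and P only, not on m.\<close>

lemma max_sim_count_lower_bound:
  fixes A P :: "complex set"
  assumes "finite A" "finite P" "card A \<ge> 2" "card P \<ge> 2" "sim_count P A > 0"
  shows "\<exists>c::real. c > 0 \<and> (\<forall>m n. m \<ge> 3 \<longrightarrow> no_collinear m A \<longrightarrow> n \<ge> card A \<longrightarrow>
    c * real n powr pattern_index P A \<le> real (max_sim_count P n m))"
proof -
  obtain S where "S \<subseteq> P" "card S = 2" using assms(4) by (meson obtain_subset_with_card_n)
  then obtain x y where xy: "x \<in> P" "y \<in> P" "x \<noteq> y" by (auto simp: card_2_iff)
  define k where "k = card A"
  define g where "g = card (Iso_plus P)"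
  define N where "N = g * sim_count P A + k"
  define i where "i = pattern_index P A"
  have g: "g > 0" using card_Iso_plus_pos assms(2) xy unfolding g_def by blast
  have k: "k \<ge> 2" using assms(3) by (simp add: k_def)
  have N: "N = card (affine_maps P A)" "N > k"
    using card_affine_maps[OF assms(2,1) xy] g assms(5) by (auto simp: N_def g_def k_def)
  have ki: "real k powr i = real N"
    using card_powr_pattern_index[OF assms(3)] by (simp add: k_def i_def N_def g_def)
  have i: "i \<ge> 0"
  proof (rule ccontr)
    assume "\<not> i \<ge> 0"
    then have "real k powr i < real k powr 0" using k by (intro powr_less_mono) auto
    then show False using ki k N(2) by simp
  qed
  \<comment> \<open>The factor 1 - k/N pays for removing the constant maps, 1/g for passing from
    maps to copies, and 1/N for rounding n down to a power of k.\<close>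
  define c where "c = (1 - real k / real N) / (real g * real N)"
  have "c > 0" using N(2) k g by (simp add: c_def)
  moreover have "c * real n powr i \<le> real (max_sim_count P n m)"
    if m: "m \<ge> 3" "no_collinear m A" and n: "n \<ge> card A" for m n
  proof -
    obtain j where j: "k ^ j \<le> n" "n < k ^ (j + 1)"
      using ex_power_ivl1[of k n] k n by (auto simp: k_def)
    \<comment> \<open>Needed because (k/N)^j is bounded by k/N only for positive j.\<close>
    have "j \<noteq> 0" using j(2) n by (intro notI) (simp add: k_def)
    obtain B where B: "finite B" "card B = k ^ j" "no_collinear m B"
      "N ^ j \<le> card (affine_maps P B)"
      using iterated_generic_sum[OF assms(2) xy assms(1) m(2,1)] unfolding k_def N(1) by blast
    have "N ^ j \<le> g * sim_count P B + k ^ j"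
      using B(4) card_affine_maps[OF assms(2) B(1) xy] B(2) by (simp add: g_def)
    also have "sim_count P B \<le> max_sim_count P n m"
      using max_sim_count_ge[OF B(1) _ B(3) m(1)] B(2) j(1) by simp
    finally have "N ^ j \<le> g * max_sim_count P n m + k ^ j" by simp
    then have main: "real N ^ j \<le> real g * real (max_sim_count P n m) + real k ^ j"
      by (metis of_nat_add of_nat_le_iff of_nat_mult of_nat_power)
    have "(real k / real N) ^ j \<le> real k / real N"
      using power_decreasing[of 1 j "real k / real N"] N(2) \<open>j \<noteq> 0\<close> by simp
    then have "real k ^ j \<le> real k / real N * real N ^ j"
      using N(2) by (simp add: power_divide pos_divide_le_eq)
    with main have low: "(1 - real k / real N) * real N ^ j \<le> real g * real (max_sim_count P n m)"
      by (simp add: algebra_simps)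
    have "real n \<le> real k ^ (j + 1)" using j(2) by (metis of_nat_le_iff of_nat_power less_imp_le)
    then have "real n powr i \<le> (real k ^ (j + 1)) powr i" using i by (simp add: powr_mono2)
    also have "(real k ^ (j + 1)) powr i = (real k powr i) ^ (j + 1)"
      by (induction j) (simp_all add: powr_mult)
    also have "\<dots> = real N ^ (j + 1)" by (simp only: ki)
    finally have "c * real n powr i \<le> c * real N ^ (j + 1)" using \<open>c > 0\<close> by simp
    also have "\<dots> = (1 - real k / real N) * real N ^ j / real g"
      using N(2) g by (simp add: c_def)
    also have "\<dots> \<le> real (max_sim_count P n m)"
      using low g by (simp add: pos_divide_le_eq mult.commute)
    finally show ?thesis .
  qed
  ultimately show ?thesis unfolding i_def by blast
qed

theorem theorem1:
  fixes A P :: "complex set"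
  assumes "finite A" and "finite P" and "card A \<ge> 2" and "card P \<ge> 3"
  shows "\<exists>c::real. c > 0 \<and>
    (\<forall>m::nat. m \<ge> 3 \<longrightarrow> no_collinear m A \<longrightarrow> no_collinear m P \<longrightarrow>
      (\<forall>\<^sub>F n in sequentially. real (max_sim_count P n m) \<ge> c * real n powr pattern_index P A))"
proof (cases "sim_count P A > 0")
  case True
  then obtain c where "c > 0" and c: "\<And>m n. m \<ge> 3 \<Longrightarrow> no_collinear m A \<Longrightarrow> n \<ge> card A \<Longrightarrow>
    c * real n powr pattern_index P A \<le> real (max_sim_count P n m)"
    using max_sim_count_lower_bound[of A P] assms by auto
  then show ?thesis unfolding eventually_sequentially by blast
next
  case False
  then have index_A: "pattern_index P A = 1" using assms(3) by (simp add: pattern_index_def)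
  have "P \<sim> P" unfolding similar_def by (intro exI[of _ 1] exI[of _ 0]) simp
  then have "P \<in> {P'. P' \<subseteq> P \<and> P' \<sim> P}" by simp
  then have pos: "sim_count P P > 0"
    unfolding sim_count_def card_gt_0_iff using assms(2) by auto
  then obtain c where "c > 0" and c: "\<And>m n. m \<ge> 3 \<Longrightarrow> no_collinear m P \<Longrightarrow> n \<ge> card P \<Longrightarrow>
    c * real n powr pattern_index P P \<le> real (max_sim_count P n m)"
    using max_sim_count_lower_bound[of P P] assms by auto
  \<comment> \<open>The numerator of the index is at least ln |P|, so the growth obtained from P is
    at least linear, which is all that index 1 for A asks for.\<close>
  have index_P: "pattern_index P P \<ge> 1"
  proof -
    have "ln (real (card P)) \<le> ln (real (card (Iso_plus P)) * real (sim_count P P) + real (card P))"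
      using assms(4) by (intro ln_mono) (auto intro: add_nonneg_pos)
    then show ?thesis using assms(4) by (simp add: pattern_index_def)
  qed
  have "c * real n powr pattern_index P A \<le> real (max_sim_count P n m)"
    if "m \<ge> 3" "no_collinear m P" "n \<ge> card P" for m n
  proof -
    have "real n powr pattern_index P A \<le> real n powr pattern_index P P"
      unfolding index_A using index_P that(3) assms(4) by (intro powr_mono) auto
    then have "c * real n powr pattern_index P A \<le> c * real n powr pattern_index P P"
      using \<open>c > 0\<close> by simp
    also have "\<dots> \<le> real (max_sim_count P n m)" using c that by blast
    finally show ?thesis .
  qed
  then show ?thesis using \<open>c > 0\<close> unfolding eventually_sequentially by blast
qed

end
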